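(* Let $f:\mathbb{Z}^2\to\mathbb{R}$ be a function vanishing at infinity and let $f^*$ denote its spiral rearrangement. Then for all $p\ge 1$ (real), $$\|\nabla f^*\|_p\;\le\;4^{1+1/p}\,\|\nabla f\|_p .$$
   Context: The lattice graph on $\mathbb{Z}^2$ has an edge $x\sim y$ iff $\|x-y\|_{\ell^1}=1$. For $g:\mathbb{Z}^2\to\mathbb{R}$, $\|\nabla g\|_p^p:=\sum_{x\sim y}|g(x)-g(y)|^p\in[0,\infty]$ (sum over edges). A function $f$ vanishes at infinity if $\{x:|f(x)|>t\}$ is finite for every $t>0$. Given a labelling, i.e. a bijection $\eta:\mathbb{N}=\{1,2,\dots\}\to\mathbb{Z}^2$, the rearrangement of $f$ with respect to $\eta$ is the function $f^*$ with $f^*(\eta(k)):=$ the $k$-th largest value of $|f|$ counted with multiplicity; precisely $f^*(\eta(k))=\sup\{t>0:|\{x:|f(x)|>t\}|\ge k\}$, with $\sup\emptyset=0$. The spiral labelling is the square spiral: $\eta(1)=(0,0)$, and then one moves by unit steps: 1 step right, 1 up, 2 left, 2 down, 3 right, 3 up, 4 left, 4 down, 5 right, 5 up, and so on, labelling the visited points consecutively (thus $\eta(2)=(1,0)$, $\eta(3)=(1,1)$, $\eta(4)=(0,1)$, $\eta(5)=(-1,1)$, $\eta(6)=(-1,0)$, $\eta(7)=(-1,-1)$, $\eta(8)=(0,-1)$, $\eta(9)=(1,-1)$, $\eta(10)=(2,-1)$, $\eta(11)=(2,0)$, ...). The spiral rearrangement is the rearrangement with respect to this labelling. *)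

theory Defs
  imports "HOL-Analysis.Analysis"
begin

type_synonym lattice = "int \<times> int"

definition adjacent :: "lattice \<Rightarrow> lattice \<Rightarrow> bool" where
  "adjacent x y \<longleftrightarrow> \<bar>fst x - fst y\<bar> + \<bar>snd x - snd y\<bar> = 1"

text \<open>Edges are unordered, so each one contributes once to the sum below.\<close>

definition lattice_edges :: "lattice set set" where
  "lattice_edges = {{x, y} | x y. adjacent x y}"

text \<open>The value \<open>\<bar>g x - g y\<bar>\<close> on the unordered edge \<open>{x, y}\<close>, expressed
  without choosing an order of the endpoints.\<close>

definition edge_increment :: "(lattice \<Rightarrow> real) \<Rightarrow> lattice set \<Rightarrow> real" where
  "edge_increment g e = Max {\<bar>g x - g y\<bar> | x y. x \<in> e \<and> y \<in> e}"

lemma edge_increment_pair: "edge_increment g {x, y} = \<bar>g x - g y\<bar>"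
proof -
  have "{\<bar>g u - g v\<bar> | u v. u \<in> {x, y} \<and> v \<in> {x, y}} = {0, \<bar>g x - g y\<bar>}" (is "?A = ?B")
  proof
    show "?A \<subseteq> ?B"
      by (auto simp: abs_minus_commute)
    have "\<bar>g x - g x\<bar> \<in> ?A" "\<bar>g x - g y\<bar> \<in> ?A"
      by blast+
    then show "?B \<subseteq> ?A"
      by simp
  qed
  then show ?thesis
    by (simp add: edge_increment_def)
qed

text \<open>\<open>grad_energy p g\<close> is the \<open>p\<close>-th power of the norm of the gradient.\<close>

definition grad_energy :: "real \<Rightarrow> (lattice \<Rightarrow> real) \<Rightarrow> ennreal" where
  "grad_energy p g = (\<Sum>\<^sub>\<infinity>e\<in>lattice_edges. ennreal (edge_increment g e powr p))"

text \<open>The \<open>p\<close>-th root has to be taken by hand, since \<open>powr\<close> is not available on \<open>ennreal\<close>.\<close>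

definition grad_norm :: "real \<Rightarrow> (lattice \<Rightarrow> real) \<Rightarrow> ennreal" where
  "grad_norm p g =
    (if grad_energy p g = \<infinity> then \<infinity> else ennreal (enn2real (grad_energy p g) powr (1 / p)))"

definition vanishes_at_infinity :: "(lattice \<Rightarrow> real) \<Rightarrow> bool" where
  "vanishes_at_infinity f \<longleftrightarrow> (\<forall>t>0. finite {x. \<bar>f x\<bar> > t})"

text \<open>The \<open>k\<close>-th largest value of \<open>\<bar>f\<bar>\<close>, for \<open>k \<ge> 1\<close> and \<open>f\<close> vanishing at infinity (so that the
  level sets are finite and \<open>card\<close> is their cardinality). The empty supremum is \<open>0\<close> here,
  whereas \<open>Sup {}\<close> is unspecified on the reals.\<close>

definition kth_largest :: "(lattice \<Rightarrow> real) \<Rightarrow> nat \<Rightarrow> real" where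
  "kth_largest f k =
    (let T = {t. t > 0 \<and> card {x. \<bar>f x\<bar> > t} \<ge> k} in if T = {} then 0 else Sup T)"

text \<open>A labelling \<open>\<eta>\<close> is a bijection from \<open>{1..}\<close>; its value at \<open>0\<close> plays no role.\<close>

definition rearrangement :: "(nat \<Rightarrow> lattice) \<Rightarrow> (lattice \<Rightarrow> real) \<Rightarrow> lattice \<Rightarrow> real" where
  "rearrangement \<eta> f x = kth_largest f (inv_into {1..} \<eta> x)"

text \<open>The legs of the spiral are numbered from \<open>0\<close>; their directions cycle through right, up, left,
  down, and their lengths are \<open>1, 1, 2, 2, 3, 3, \<dots>\<close>. A state \<open>(x, j, i)\<close> consists of the current
  point \<open>x\<close>, the current leg \<open>j\<close> and the number \<open>i\<close> of steps already taken in that leg.\<close>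

definition leg_direction :: "nat \<Rightarrow> lattice" where
  "leg_direction j = [(1, 0), (0, 1), (-1, 0), (0, -1)] ! (j mod 4)"

definition leg_length :: "nat \<Rightarrow> nat" where
  "leg_length j = j div 2 + 1"

fun spiral_step :: "lattice \<times> nat \<times> nat \<Rightarrow> lattice \<times> nat \<times> nat" where
  "spiral_step (x, j, i) =
    (x + leg_direction j, if i + 1 = leg_length j then (j + 1, 0) else (j, i + 1))"

definition spiral :: "nat \<Rightarrow> lattice" where
  "spiral k = fst ((spiral_step ^^ (k - 1)) ((0, 0), 0, 0))"

lemma spiral_first_values:
  "map spiral [1..<12] =
    [(0, 0), (1, 0), (1, 1), (0, 1), (-1, 1), (-1, 0), (-1, -1), (0, -1), (1, -1), (2, -1), (2, 0)]"
  by code_simp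

definition spiral_rearrangement :: "(lattice \<Rightarrow> real) \<Rightarrow> lattice \<Rightarrow> real" where
  "spiral_rearrangement = rearrangement spiral"

end

theory Submission
  imports Defs
begin

text \<open>
  Let \<open>a k\<close> be the \<open>k\<close>-th largest value of \<open>\<bar>f\<bar>\<close>, let \<open>T l\<close> be the \<open>l\<close>-th triangular number and put
  \<open>D l = a (T l) - a (T (l + 1))\<close>. Both energies are compared with a weighted sum of the \<open>D l ^ p\<close>.

  If \<open>D l > 0\<close>, the set \<open>A\<close> where \<open>\<bar>f\<bar> \<ge> a (T l)\<close> has at least \<open>T l\<close> points, and the set \<open>C\<close> where
  \<open>\<bar>f\<bar> > a (T (l + 1))\<close> has at most \<open>l\<close> further points. The two ends of each row and of each column
  of \<open>A\<close> yield many edges that lead from \<open>A\<close> out of \<open>C\<close>, and \<open>f\<close> varies by at least \<open>D l\<close> on each of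
  them. Since \<open>x \<mapsto> x ^ p\<close> is superadditive, an edge may be charged for several \<open>l\<close> at once.

  Neighbours with spiral labels \<open>i < j\<close> satisfy \<open>j \<le> i + 4 * sqrt i + 5\<close>. So the increment of the
  rearrangement along an edge is at most a sum of four consecutive \<open>D l\<close>, to which Jensen's
  inequality applies, and each \<open>l\<close> is used by at most \<open>12 * l - 5\<close> edges.
\<close>

subsection \<open>Labels of the square spiral\<close>

text \<open>The closed form of the inverse of \<open>spiral\<close>: the ring \<open>max \<bar>x\<bar> \<bar>y\<bar> = n > 0\<close> carries the labels in
  \<open>{(2 * n - 1)\<^sup>2 <.. (2 * n + 1)\<^sup>2}\<close>, and the four cases are its bottom, left, top and right sides.\<close>

definition spiral_label :: "lattice \<Rightarrow> int" where
  "spiral_label v = (case v of (x, y) \<Rightarrow> let n = max \<bar>x\<bar> \<bar>y\<bar> in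
     (2 * n - 1)\<^sup>2 +
     (if y = - n then 7 * n + x else if x = - n then 5 * n - y
      else if y = n then 3 * n - x else n + y))"

lemma spiral_label_ring:
  assumes "max \<bar>x\<bar> \<bar>y\<bar> = n"
  shows "spiral_label (x, y) = (2 * n - 1)\<^sup>2 +
     (if y = - n then 7 * n + x else if x = - n then 5 * n - y
      else if y = n then 3 * n - x else n + y)"
  unfolding spiral_label_def prod.case Let_def assms ..

text \<open>On ring \<open>n > 0\<close> the offset added to \<open>(2 * n - 1)\<^sup>2\<close> lies
  between 1 and \<open>8 * n\<close>, and \<open>8 * n\<close> is the difference of the two odd
  squares. For \<open>n = 0\<close> the offset is 0 and the square is that of -1.\<close>

lemma spiral_label_bounds:
  assumes "max \<bar>x\<bar> \<bar>y\<bar> = n"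
  shows "spiral_label (x, y) \<le> (2 * n + 1)\<^sup>2"
    and "n > 0 \<Longrightarrow> (2 * n - 1)\<^sup>2 < spiral_label (x, y)"
    and "n = 0 \<Longrightarrow> spiral_label (x, y) = 1"
proof -
  have n: "\<bar>x\<bar> \<le> n" "\<bar>y\<bar> \<le> n" "\<bar>x\<bar> = n \<or> \<bar>y\<bar> = n" using assms by linarith+
  define b where "b = (if y = - n then 7 * n + x else if x = - n then 5 * n - y
      else if y = n then 3 * n - x else n + y)"
  have lab: "spiral_label (x, y) = (2 * n - 1)\<^sup>2 + b"
    using spiral_label_ring[OF assms] b_def by simp
  have b: "b \<le> 8 * n" "n > 0 \<Longrightarrow> b > 0" "n = 0 \<Longrightarrow> b = 0"
    using n unfolding b_def by (smt (verit))+
  have "(2 * n + 1)\<^sup>2 = (2 * n - 1)\<^sup>2 + 8 * n" by (simp add: power2_eq_square algebra_simps)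
  then show "spiral_label (x, y) \<le> (2 * n + 1)\<^sup>2"
    and "n > 0 \<Longrightarrow> (2 * n - 1)\<^sup>2 < spiral_label (x, y)"
    and "n = 0 \<Longrightarrow> spiral_label (x, y) = 1" using lab b by simp_all
qed

lemma spiral_label_ge_1: "spiral_label v \<ge> 1"
proof -
  obtain x y where v: "v = (x, y)" by (cases v)
  obtain n where n: "max \<bar>x\<bar> \<bar>y\<bar> = n" by simp
  then have "n = 0 \<or> n > 0" by linarith
  moreover have "(2 * n - 1)\<^sup>2 \<ge> 0" by simp
  ultimately show ?thesis using spiral_label_bounds(2,3)[OF n] unfolding v by linarith
qed

text \<open>Different rings carry disjoint intervals of labels. Within a ring \<open>n > 0\<close>
  the offsets on the right, top, left and bottom sides fill \<open>1..2n-1\<close>,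
  \<open>2n..4n-1\<close>, \<open>4n..6n-1\<close> and \<open>6n..8n\<close>, so an offset
  determines first the side and then the point.\<close>

lemma inj_spiral_label: "inj spiral_label"
proof (rule injI)
  fix v w assume eq: "spiral_label v = spiral_label w"
  obtain x y where v: "v = (x, y)" by (cases v)
  obtain x' y' where w: "w = (x', y')" by (cases w)
  have lt: "spiral_label (a, b) < spiral_label (c, d)"
    if "max \<bar>a\<bar> \<bar>b\<bar> = n" "max \<bar>c\<bar> \<bar>d\<bar> = m" "n < m" for a b c d n m
  proof -
    have "0 \<le> n" using that by linarith
    have "(2 * n + 1)\<^sup>2 \<le> (2 * m - 1)\<^sup>2"
      using \<open>0 \<le> n\<close> that by (intro power_mono) linarith+
    then show ?thesis
      using spiral_label_bounds(1)[OF that(1)] spiral_label_bounds(2)[OF that(2)] \<open>0 \<le> n\<close> that(3)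
      by linarith
  qed
  obtain n where n: "max \<bar>x\<bar> \<bar>y\<bar> = n" by simp
  have n': "max \<bar>x'\<bar> \<bar>y'\<bar> = n"
    using lt[of x y n x' y'] lt[of x' y' _ x y n] eq v w n
    by (metis less_irrefl linorder_neqE)
  have "(if y = - n then 7 * n + x else if x = - n then 5 * n - y
      else if y = n then 3 * n - x else n + y) =
      (if y' = - n then 7 * n + x' else if x' = - n then 5 * n - y'
      else if y' = n then 3 * n - x' else n + y')"
    using eq unfolding v w spiral_label_ring[OF n] spiral_label_ring[OF n'] by linarith
  with n n' have "x = x' \<and> y = y'" by (smt (verit))
  then show "v = w" using v w by simp
qed

section \<open>The walk traced leg by leg\<close>

definition leg_start :: "nat \<Rightarrow> lattice" where
  "leg_start j = (let q = int (j div 4) in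
     [(- q, - q), (q + 1, - q), (q + 1, q + 1), (- q - 1, q + 1)] ! (j mod 4))"

lemma mod4_cases:
  fixes j :: nat
  obtains q where "j = 4 * q" | q where "j = 4 * q + 1" | q where "j = 4 * q + 2" | q where "j = 4 * q + 3"
proof -
  have "j = 4 * (j div 4) + j mod 4" "j mod 4 < 4" by auto
  moreover have "j mod 4 = 0 \<or> j mod 4 = 1 \<or> j mod 4 = 2 \<or> j mod 4 = 3" by linarith
  ultimately show ?thesis using that by (metis add.right_neutral)
qed

lemma leg_simps:
  "leg_start (4 * q) = (- int q, - int q)"
  "leg_start (4 * q + 1) = (int q + 1, - int q)"
  "leg_start (4 * q + 2) = (int q + 1, int q + 1)"
  "leg_start (4 * q + 3) = (- int q - 1, int q + 1)"
  "leg_direction (4 * q) = (1, 0)"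
  "leg_direction (4 * q + 1) = (0, 1)"
  "leg_direction (4 * q + 2) = (-1, 0)"
  "leg_direction (4 * q + 3) = (0, -1)"
  "leg_length (4 * q) = 2 * q + 1"
  "leg_length (4 * q + 1) = 2 * q + 1"
  "leg_length (4 * q + 2) = 2 * q + 2"
  "leg_length (4 * q + 3) = 2 * q + 2"
proof -
  have m: "(4 * q) mod 4 = 0" "(4 * q + 1) mod 4 = 1" "(4 * q + 2) mod 4 = 2" "(4 * q + 3) mod 4 = 3"
    by presburger+
  have d: "(4 * q) div 4 = q" "(4 * q + 1) div 4 = q" "(4 * q + 2) div 4 = q" "(4 * q + 3) div 4 = q"
    by presburger+
  have n: "[a, b, c, e] ! 0 = a" "[a, b, c, e] ! 1 = b" "[a, b, c, e] ! 2 = c" "[a, b, c, e] ! 3 = e"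
    for a b c e :: lattice
    by (simp_all add: numeral_eq_Suc)
  show
  "leg_start (4 * q) = (- int q, - int q)"
  "leg_start (4 * q + 1) = (int q + 1, - int q)"
  "leg_start (4 * q + 2) = (int q + 1, int q + 1)"
  "leg_start (4 * q + 3) = (- int q - 1, int q + 1)"
    unfolding leg_start_def Let_def m d n by (rule refl)+
  show
  "leg_direction (4 * q) = (1, 0)"
  "leg_direction (4 * q + 1) = (0, 1)"
  "leg_direction (4 * q + 2) = (-1, 0)"
  "leg_direction (4 * q + 3) = (0, -1)"
    unfolding leg_direction_def m n by (rule refl)+
  show
  "leg_length (4 * q) = 2 * q + 1"
  "leg_length (4 * q + 1) = 2 * q + 1"
  "leg_length (4 * q + 2) = 2 * q + 2"
  "leg_length (4 * q + 3) = 2 * q + 2"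
    unfolding leg_length_def by presburger+
qed

text \<open>Legs \<open>4 * q\<close> to \<open>4 * q + 3\<close> form one turn around the origin,
  and the closed form rises by one per step on each. The far corner is included in the range of
  \<open>t\<close>, so that every step of a leg, the last one too, is covered.\<close>

lemma spiral_label_leg:
  fixes q t :: int
  assumes "q \<ge> 0" "0 \<le> t"
  shows "t \<le> 2 * q + 1 \<Longrightarrow> spiral_label (- q + t, - q) = 4 * q\<^sup>2 + 2 * q + 1 + t"
    and "t \<le> 2 * q + 1 \<Longrightarrow> spiral_label (q + 1, - q + t) = 4 * q\<^sup>2 + 4 * q + 2 + t"
    and "t \<le> 2 * q + 2 \<Longrightarrow> spiral_label (q + 1 - t, q + 1) = 4 * q\<^sup>2 + 6 * q + 3 + t"
    and "t \<le> 2 * q + 2 \<Longrightarrow> spiral_label (- q - 1, q + 1 - t) = 4 * q\<^sup>2 + 8 * q + 5 + t"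
proof -
  have sq: "(2 * q - 1)\<^sup>2 = 4 * q\<^sup>2 - 4 * q + 1" "(2 * (q + 1) - 1)\<^sup>2 = 4 * q\<^sup>2 + 4 * q + 1"
    by (simp_all add: power2_eq_square algebra_simps)
  show "spiral_label (- q + t, - q) = 4 * q\<^sup>2 + 2 * q + 1 + t" if "t \<le> 2 * q + 1"
  \<comment> \<open>The last step of the leg to the right leaves the bottom of ring \<open>q\<close>
    for ring \<open>q + 1\<close>; the other three legs of the turn stay on ring
    \<open>q + 1\<close>.\<close>
  proof (cases "t = 2 * q + 1")
    case True
    then have "max \<bar>- q + t\<bar> \<bar>- q\<bar> = q + 1" using assms by linarith
    from spiral_label_ring[OF this, unfolded sq] show ?thesis using assms True by simp
  next
    case False
    then have "max \<bar>- q + t\<bar> \<bar>- q\<bar> = q" using assms that by linarith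
    from spiral_label_ring[OF this, unfolded sq] show ?thesis by simp
  qed
  show "spiral_label (q + 1, - q + t) = 4 * q\<^sup>2 + 4 * q + 2 + t" if "t \<le> 2 * q + 1"
  proof -
    have "max \<bar>q + 1\<bar> \<bar>- q + t\<bar> = q + 1" using assms that by linarith
    from spiral_label_ring[OF this, unfolded sq] show ?thesis using assms that by simp
  qed
  show "spiral_label (q + 1 - t, q + 1) = 4 * q\<^sup>2 + 6 * q + 3 + t" if "t \<le> 2 * q + 2"
  proof -
    have "max \<bar>q + 1 - t\<bar> \<bar>q + 1\<bar> = q + 1" using assms that by linarith
    from spiral_label_ring[OF this, unfolded sq] show ?thesis using assms that by simp
  qed
  show "spiral_label (- q - 1, q + 1 - t) = 4 * q\<^sup>2 + 8 * q + 5 + t" if "t \<le> 2 * q + 2"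
  proof -
    have "max \<bar>- q - 1\<bar> \<bar>q + 1 - t\<bar> = q + 1" using assms that by linarith
    from spiral_label_ring[OF this, unfolded sq] show ?thesis using assms that by simp
  qed
qed

definition leg_point :: "nat \<Rightarrow> nat \<Rightarrow> lattice" where
  "leg_point j i = (fst (leg_start j) + int i * fst (leg_direction j),
     snd (leg_start j) + int i * snd (leg_direction j))"

lemma leg_point_simps:
  "leg_point (4 * q) i = (- int q + int i, - int q)"
  "leg_point (4 * q + 1) i = (int q + 1, - int q + int i)"
  "leg_point (4 * q + 2) i = (int q + 1 - int i, int q + 1)"
  "leg_point (4 * q + 3) i = (- int q - 1, int q + 1 - int i)"
  unfolding leg_point_def leg_simps by simp_all

lemma leg_point_Suc: "leg_point j (Suc i) = leg_point j i + leg_direction j"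
  by (simp add: leg_point_def algebra_simps prod_eq_iff)

lemma leg_point_end: "leg_point j (leg_length j) = leg_point (Suc j) 0"
proof -
  have "Suc (4 * q) = 4 * q + 1" "Suc (4 * q + 1) = 4 * q + 2" "Suc (4 * q + 2) = 4 * q + 3"
    "Suc (4 * q + 3) = 4 * Suc q" for q
    by simp_all
  note suc = this
  show ?thesis
    by (cases j rule: mod4_cases)
      (simp_all only: suc leg_point_simps leg_simps, simp_all)
qed

lemma spiral_label_leg_point_Suc:
  assumes "i < leg_length j"
  shows "spiral_label (leg_point j (Suc i)) = spiral_label (leg_point j i) + 1"
proof (cases j rule: mod4_cases)
  case (1 q)
  then have "i < 2 * q + 1" using assms leg_simps by metis
  then have "int i + 1 \<le> 2 * int q + 1" by linarith
  then show ?thesis unfolding 1 leg_point_simps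
    using spiral_label_leg(1)[of "int q" "int i"] spiral_label_leg(1)[of "int q" "int (Suc i)"] by simp
next
  case (2 q)
  then have "i < 2 * q + 1" using assms leg_simps by metis
  then have "int i + 1 \<le> 2 * int q + 1" by linarith
  then show ?thesis unfolding 2 leg_point_simps
    using spiral_label_leg(2)[of "int q" "int i"] spiral_label_leg(2)[of "int q" "int (Suc i)"] by simp
next
  case (3 q)
  then have "i < 2 * q + 2" using assms leg_simps by metis
  then have "int i + 1 \<le> 2 * int q + 2" by linarith
  then show ?thesis unfolding 3 leg_point_simps
    using spiral_label_leg(3)[of "int q" "int i"] spiral_label_leg(3)[of "int q" "int (Suc i)"] by simp
next
  case (4 q)
  then have "i < 2 * q + 2" using assms leg_simps by metis
  then have "int i + 1 \<le> 2 * int q + 2" by linarith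
  then show ?thesis unfolding 4 leg_point_simps
    using spiral_label_leg(4)[of "int q" "int i"] spiral_label_leg(4)[of "int q" "int (Suc i)"] by simp
qed

text \<open>This is the invariant of the walk. A finished leg is replaced at once by the next one,
  so \<open>i\<close> stays strictly below the length and each step raises the label by one; the
  start already has label 1.\<close>

lemma spiral_state:
  "\<exists>j i. i < leg_length j \<and> (spiral_step ^^ n) ((0, 0), 0, 0) = (leg_point j i, j, i) \<and>
     spiral_label (leg_point j i) = int n + 1"
proof (induction n)
  case 0
  have "leg_point 0 0 = (0, 0)" using leg_point_simps(1)[of 0 0] by simp
  then show ?case
    by (intro exI[of _ 0]) (simp add: leg_length_def spiral_label_def)
next
  case (Suc n)
  then obtain j i where ij: "i < leg_length j"
    "(spiral_step ^^ n) ((0, 0), 0, 0) = (leg_point j i, j, i)"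
    "spiral_label (leg_point j i) = int n + 1" by blast
  note lab = spiral_label_leg_point_Suc[OF ij(1)]
  show ?case
  proof (cases "Suc i = leg_length j")
    case True
    then have "leg_point j (Suc i) = leg_point (Suc j) 0" using leg_point_end by simp
    then show ?thesis using ij lab True
      by (intro exI[of _ "Suc j"] exI[of _ 0]) (auto simp: leg_point_Suc leg_length_def)
  next
    case False
    then show ?thesis using ij lab
      by (intro exI[of _ j] exI[of _ "Suc i"]) (auto simp: leg_point_Suc)
  qed
qed

lemma spiral_label_spiral: "k \<ge> 1 \<Longrightarrow> spiral_label (spiral k) = int k"
  using spiral_state[of "k - 1"] unfolding spiral_def by auto

text \<open>Both sides carry the same label, and labels are injective. So every lattice point is
  visited, without a separate argument for surjectivity.\<close>

lemma spiral_of_label: "spiral (nat (spiral_label v)) = v"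
proof (rule injD[OF inj_spiral_label])
  show "spiral_label (spiral (nat (spiral_label v))) = spiral_label v"
    using spiral_label_spiral[of "nat (spiral_label v)"] spiral_label_ge_1[of v] by simp
qed

lemma inv_into_spiral: "inv_into {1..} spiral v = nat (spiral_label v)"
proof (rule inv_into_f_eq)
  show "inj_on spiral {1..}"
    by (rule inj_on_inverseI[of _ "\<lambda>v. nat (spiral_label v)"]) (simp add: spiral_label_spiral)
qed (use spiral_label_ge_1[of v] in \<open>auto simp: spiral_of_label\<close>)

lemma adjacent_spiral_Suc:
  assumes "k \<ge> 1"
  shows "adjacent (spiral k) (spiral (Suc k))"
proof -
  obtain j i where ij: "(spiral_step ^^ (k - 1)) ((0, 0), 0, 0) = (leg_point j i, j, i)"
    using spiral_state by blast
  have "(spiral_step ^^ k) ((0, 0), 0, 0) = spiral_step (leg_point j i, j, i)"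
    using assms ij by (cases k) auto
  then have "spiral (Suc k) = spiral k + leg_direction j"
    unfolding spiral_def using ij by simp
  moreover have "\<bar>fst (leg_direction j)\<bar> + \<bar>snd (leg_direction j)\<bar> = 1"
    by (cases j rule: mod4_cases) (simp_all only: leg_simps, simp_all)
  ultimately show ?thesis by (simp add: adjacent_def)
qed

text \<open>Labels on ring \<open>n\<close> are about \<open>4 * n\<^sup>2\<close>, while neighbours
  are at most about \<open>8 * n\<close> labels apart. Squaring keeps the bound
  \<open>d \<le> 5 + 4 * sqrt i\<close> within the integers, at the price of treating
  \<open>d \<le> 5\<close> separately.\<close>

lemma spiral_label_span:
  assumes "adjacent v w" "spiral_label v < spiral_label w"
  defines "d \<equiv> spiral_label w - spiral_label v"
  shows "d \<le> 5 \<or> (d - 5)\<^sup>2 \<le> 16 * spiral_label v"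
proof -
  obtain x y where v: "v = (x, y)" by (cases v)
  obtain x' y' where w: "w = (x', y')" by (cases w)
  have adj: "\<bar>x - x'\<bar> + \<bar>y - y'\<bar> = 1" using assms v w by (simp add: adjacent_def)
  obtain n where n: "max \<bar>x\<bar> \<bar>y\<bar> = n" by simp
  obtain m where m: "max \<bar>x'\<bar> \<bar>y'\<bar> = m" by simp
  define b where "b = (if y = - n then 7 * n + x else if x = - n then 5 * n - y
      else if y = n then 3 * n - x else n + y)"
  define b' where "b' = (if y' = - m then 7 * m + x' else if x' = - m then 5 * m - y'
      else if y' = m then 3 * m - x' else m + y')"
  have lv: "spiral_label v = (2 * n - 1)\<^sup>2 + b" and lw: "spiral_label w = (2 * m - 1)\<^sup>2 + b'"
    using spiral_label_ring[OF n] spiral_label_ring[OF m] v w b_def b'_def by auto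
  have "n \<ge> 0" "m \<ge> 0" using n m by linarith+
  have "m = n \<or> m = n + 1 \<or> n = m + 1" using n m adj by (smt (verit))
  then consider "m = n" | "m = n + 1" | "n = m + 1" by blast
  then show ?thesis
  proof cases
    case 1
    then have "d = b' - b" using lv lw d_def by simp
    \<comment> \<open>The second alternative is the place where the ring closes up: its first label
      and its last one are adjacent.\<close>
    moreover have "b' - b \<le> 1 \<or> b = 1 \<and> b' = 8 * n \<and> n \<ge> 1"
      using adj n m 1 unfolding b_def b'_def by (smt (verit))
    ultimately consider "d \<le> 5" | "d = 8 * n - 1" "b = 1" "n \<ge> 1" by linarith
    then show ?thesis
    proof cases
      case 2
      have "(8 * n - 1 - 5)\<^sup>2 \<le> 16 * ((2 * n - 1)\<^sup>2 + 1)"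
        using \<open>n \<ge> 1\<close> by (simp add: power2_eq_square algebra_simps)
      then show ?thesis using 2 lv by simp
    qed simp
  next
    case 2
    then have "d = 8 * n + (b' - b)" using lv lw d_def by (simp add: power2_eq_square algebra_simps)
    \<comment> \<open>The gap 1 occurs where the walk itself enters the next ring. Otherwise an
      outward step from the right, top, left or bottom side gives \<open>8 * n\<close> plus 1, 3, 5
      or 7; the later sides have larger gaps, but also larger offsets \<open>b\<close> to pay for
      them.\<close>
    moreover have "8 * n + (b' - b) = 1 \<or> b' - b = 1 \<and> b \<ge> 0 \<or> b' - b = 3 \<and> b \<ge> 2 * n \<or>
        b' - b = 5 \<and> b \<ge> 4 * n \<or> b' - b = 7 \<and> b \<ge> 6 * n"
      using adj n m 2 unfolding b_def b'_def by (smt (verit))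
    ultimately consider "d \<le> 5" | "d = 8 * n + 1" "b \<ge> 0" | "d = 8 * n + 3" "b \<ge> 2 * n"
      | "d = 8 * n + 5" "b \<ge> 4 * n" | "d = 8 * n + 7" "b \<ge> 6 * n"
      by linarith
    then show ?thesis
      by cases (use \<open>n \<ge> 0\<close> in \<open>simp_all add: lv power2_eq_square algebra_simps\<close>)
  next
    case 3
    have "spiral_label w \<le> (2 * m + 1)\<^sup>2" using spiral_label_bounds(1)[OF m] w by simp
    also have "\<dots> = (2 * n - 1)\<^sup>2" using 3 by (simp add: add.commute)
    also have "\<dots> < spiral_label v" using spiral_label_bounds(2)[OF n] v 3 \<open>m \<ge> 0\<close> by simp
    finally show ?thesis using assms(2) by simp
  qed
qed

subsection \<open>Triangular levels\<close>

declare triangle_Suc [simp del]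

lemma double_triangle: "2 * triangle l = l * (l + 1)"
  unfolding triangle_def by simp

lemma mono_triangle: "mono triangle"
  unfolding mono_iff_le_Suc by (simp add: triangle_Suc)

text \<open>A label \<open>i\<close> below \<open>triangle (Suc l)\<close> satisfies \<open>16 * i
  \<le> 8 * l\<^sup>2 + 24 * l \<le> (3 * l + 5)\<^sup>2\<close>, hence the gap is at most
  \<open>3 * l + 10\<close>. This exceeds
  \<open>triangle (l + 4) - triangle (l + 1) = 3 * l + 9\<close> by one, which the strict inequality
  for \<open>i\<close> absorbs.\<close>

lemma spiral_label_span_triangle:
  assumes "adjacent v w" "spiral_label v < int (triangle (Suc l))"
  shows "spiral_label w \<le> int (triangle (l + 4))"
proof (cases "spiral_label v < spiral_label w")
  case True
  define d where "d = spiral_label w - spiral_label v"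
  have T: "int (triangle (l + 4)) = int (triangle (Suc l)) + 3 * int l + 9"
    by (simp add: triangle_Suc numeral_eq_Suc)
  have "2 * int (triangle (Suc l)) = (int l + 1) * (int l + 2)"
    using arg_cong[OF double_triangle[of "Suc l"], of int] by (simp add: algebra_simps)
  moreover have "16 * spiral_label v \<le> 8 * (2 * int (triangle (Suc l))) - 16" using assms(2) by simp
  ultimately have i: "16 * spiral_label v \<le> 8 * ((int l + 1) * (int l + 2)) - 16" by simp
  have "d - 5 \<le> 3 * int l + 5"
  proof (cases "d \<le> 5")
    case False
    then have "(d - 5)\<^sup>2 \<le> 16 * spiral_label v"
      using spiral_label_span[OF assms(1) True] d_def by simp
    also have "\<dots> \<le> 8 * ((int l)\<^sup>2 + 3 * int l)" using i by (simp add: power2_eq_square algebra_simps)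
    also have "\<dots> \<le> 9 * (int l)\<^sup>2 + 30 * int l + 25" by simp
    also have "\<dots> = (3 * int l + 5)\<^sup>2" by (simp add: power2_eq_square algebra_simps)
    finally show ?thesis by (rule power2_le_imp_le) simp
  qed simp
  then show ?thesis using assms(2) T d_def by simp
next
  case False
  moreover have "triangle (Suc l) \<le> triangle (l + 4)" by (rule monoD[OF mono_triangle]) simp
  ultimately show ?thesis using assms(2) by linarith
qed

definition triangle_level :: "nat \<Rightarrow> nat" where
  "triangle_level i = (LEAST l. i < triangle (Suc l))"

lemma triangle_level_bounds:
  shows "triangle (triangle_level i) \<le> i" and "i < triangle (Suc (triangle_level i))"
proof -
  have "i < triangle (Suc i)" by (simp add: triangle_Suc)
  then show "i < triangle (Suc (triangle_level i))" unfolding triangle_level_def by (rule LeastI)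
  show "triangle (triangle_level i) \<le> i"
  proof (cases "triangle_level i")
    case (Suc m)
    then have "\<not> i < triangle (Suc m)"
      using not_less_Least[of m "\<lambda>l. i < triangle (Suc l)"] unfolding triangle_level_def by simp
    then show ?thesis using Suc by simp
  qed simp
qed

subsection \<open>Sums of powers\<close>

lemma powr_mean_le:
  fixes d :: "'a \<Rightarrow> real"
  assumes "finite S" "p \<ge> 1" "\<And>i. i \<in> S \<Longrightarrow> d i \<ge> 0"
  shows "(\<Sum>i\<in>S. d i) powr p \<le> real (card S) powr (p - 1) * (\<Sum>i\<in>S. d i powr p)"
proof -
  \<comment> \<open>Jensen's inequality is applied on the positive reals, so the zero terms are
    dropped first. Returning from \<open>card P\<close> to \<open>card S\<close> only enlarges the
    factor, as \<open>p - 1 \<ge> 0\<close>.\<close>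
  define P where "P = {i \<in> S. d i > 0}"
  have P: "finite P" "P \<subseteq> S" using assms(1) by (auto simp: P_def)
  have zero: "d i = 0" if "i \<in> S - P" for i using that assms(3)[of i] by (auto simp: P_def)
  have s1: "(\<Sum>i\<in>P. d i) = (\<Sum>i\<in>S. d i)" and s2: "(\<Sum>i\<in>P. d i powr p) = (\<Sum>i\<in>S. d i powr p)"
    by (rule sum.mono_neutral_left; use assms(1) P zero in auto)+
  show ?thesis
  proof (cases "P = {}")
    case True
    then show ?thesis using s1[symmetric] by (simp add: sum_nonneg)
  next
    case False
    define n where "n = real (card P)"
    have n: "n > 0" using False P by (simp add: n_def card_gt_0_iff)
    have "(\<Sum>i\<in>P. (1 / n) *\<^sub>R d i) powr p \<le> (\<Sum>i\<in>P. (1 / n) * d i powr p)"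
      by (rule convex_on_sum[OF P(1) False powr_convex[OF assms(2)]])
        (use n in \<open>auto simp: P_def n_def\<close>)
    then have "((\<Sum>i\<in>P. d i) / n) powr p \<le> (\<Sum>i\<in>P. d i powr p) / n"
      by (simp add: sum_divide_distrib)
    then have "(\<Sum>i\<in>P. d i) powr p / n powr p \<le> (\<Sum>i\<in>P. d i powr p) / n"
      using n by (simp add: powr_divide sum_nonneg P_def)
    then have "(\<Sum>i\<in>P. d i) powr p \<le> n powr (p - 1) * (\<Sum>i\<in>P. d i powr p)"
      using n by (simp add: powr_diff field_simps)
    also have "\<dots> \<le> real (card S) powr (p - 1) * (\<Sum>i\<in>P. d i powr p)"
      using P assms card_mono[OF assms(1) P(2)]
      by (intro mult_right_mono powr_mono2) (auto simp: n_def sum_nonneg)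
    finally show ?thesis unfolding s1 s2 .
  qed
qed

text \<open>With \<open>s\<close> the whole sum, each term satisfies \<open>d i powr p = d i * d i
  powr (p - 1) \<le> d i * s powr (p - 1)\<close>.\<close>

lemma sum_powr_le_powr_sum:
  fixes d :: "'a \<Rightarrow> real"
  assumes "finite S" "p \<ge> 1" "\<And>i. i \<in> S \<Longrightarrow> d i \<ge> 0"
  shows "(\<Sum>i\<in>S. d i powr p) \<le> (\<Sum>i\<in>S. d i) powr p"
proof -
  define s where "s = (\<Sum>i\<in>S. d i)"
  have "s \<ge> 0" using assms by (simp add: s_def sum_nonneg)
  have split: "x powr p = x * x powr (p - 1)" if "x \<ge> 0" for x :: real
    using that powr_mult_base[of x "p - 1"] by simp
  have "(\<Sum>i\<in>S. d i powr p) \<le> (\<Sum>i\<in>S. d i * s powr (p - 1))"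
  proof (rule sum_mono)
    fix i assume i: "i \<in> S"
    then have "d i \<le> s" unfolding s_def using assms by (intro member_le_sum) auto
    then show "d i powr p \<le> d i * s powr (p - 1)"
      using i assms by (subst split) (auto intro!: mult_left_mono powr_mono2)
  qed
  also have "\<dots> = s powr p"
    using split[OF \<open>s \<ge> 0\<close>] by (simp add: s_def sum_distrib_right)
  finally show ?thesis unfolding s_def .
qed

text \<open>Filling the gaps of \<open>S\<close> adds only nonnegative decrements, and the filled
  sum telescopes. This lets one edge pay for all the levels it crosses; \<open>lo \<le> hi\<close>
  handles the empty \<open>S\<close>.\<close>

lemma sum_decrements_le:
  fixes c :: "nat \<Rightarrow> real"
  assumes "finite S" "S \<subseteq> {1..}" and dec: "\<And>l. l \<ge> 1 \<Longrightarrow> c (Suc l) \<le> c l"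
    and lo: "\<And>l. l \<in> S \<Longrightarrow> lo \<le> c (Suc l)" and hi: "\<And>l. l \<in> S \<Longrightarrow> c l \<le> hi" and "lo \<le> hi"
  shows "(\<Sum>l\<in>S. c l - c (Suc l)) \<le> hi - lo"
proof (cases "S = {}")
  case False
  have "(\<Sum>l\<in>S. c l - c (Suc l)) \<le> (\<Sum>l\<in>{Min S..Max S}. c l - c (Suc l))"
  proof (rule sum_mono2)
    show "S \<subseteq> {Min S..Max S}" using assms(1) by auto
    have "Min S \<ge> 1" using Min_in[OF assms(1) False] assms(2) by auto
    then show "0 \<le> c b - c (Suc b)" if "b \<in> {Min S..Max S} - S" for b
      using dec[of b] that by auto
  qed simp
  also have "\<dots> = c (Min S) - c (Suc (Max S))"
  proof -
    have "Min S \<le> Suc (Max S)" using assms(1) False Min_le[OF _ Max_in] by (simp add: le_SucI)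
    from sum_Suc_diff[OF this, of "\<lambda>l. - c l"] show ?thesis
      by simp
  qed
  also have "\<dots> \<le> hi - lo"
    using lo[OF Max_in] hi[OF Min_in] assms(1) False by (intro diff_mono) auto
  finally show ?thesis .
qed (use assms in simp)

subsection \<open>The decreasing rearrangement\<close>

lemma vanishes_at_infinity_bounded:
  assumes "vanishes_at_infinity f"
  obtains M where "\<And>x. \<bar>f x\<bar> \<le> M" "M > 0"
proof -
  have fin: "finite {x. \<bar>f x\<bar> > 1}" using assms by (simp add: vanishes_at_infinity_def)
  define M where "M = Max (insert 1 ((\<lambda>x. \<bar>f x\<bar>) ` {x. \<bar>f x\<bar> > 1}))"
  have "M \<ge> 1" unfolding M_def using fin by (intro Max_ge) auto
  moreover have "\<bar>f x\<bar> \<le> M" for x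
  proof (cases "\<bar>f x\<bar> > 1")
    case True
    then show ?thesis unfolding M_def using fin by (intro Max_ge) auto
  next
    case False
    then show ?thesis using \<open>M \<ge> 1\<close> by linarith
  qed
  ultimately show ?thesis using that by force
qed

context
  fixes f :: "lattice \<Rightarrow> real"
  assumes f: "vanishes_at_infinity f"
begin

lemma finite_superlevel: "t > 0 \<Longrightarrow> finite {x. \<bar>f x\<bar> > t}"
  using f by (simp add: vanishes_at_infinity_def)

lemma kth_largest_bdd_above:
  assumes "k \<ge> 1"
  shows "bdd_above {t. t > 0 \<and> card {x. \<bar>f x\<bar> > t} \<ge> k}"
proof -
  obtain M where M: "\<And>x. \<bar>f x\<bar> \<le> M" using vanishes_at_infinity_bounded[OF f] by blast
  show ?thesis
  proof (rule bdd_aboveI)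
    fix t assume "t \<in> {t. t > 0 \<and> card {x. \<bar>f x\<bar> > t} \<ge> k}"
    then have "card {x. \<bar>f x\<bar> > t} \<noteq> 0" using assms by simp
    then have "{x. \<bar>f x\<bar> > t} \<noteq> {}" by (metis card.empty)
    then obtain x where "\<bar>f x\<bar> > t" by blast
    then show "t \<le> M" using M[of x] by simp
  qed
qed

lemma le_kth_largest:
  assumes "k \<ge> 1" "t > 0" "card {x. \<bar>f x\<bar> > t} \<ge> k"
  shows "t \<le> kth_largest f k"
  using assms kth_largest_bdd_above[OF assms(1)]
  by (auto simp: kth_largest_def Let_def intro: cSup_upper)

lemma kth_largest_nonneg:
  assumes "k \<ge> 1"
  shows "kth_largest f k \<ge> 0"
proof (cases "\<exists>t>0. card {x. \<bar>f x\<bar> > t} \<ge> k")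
  case True
  then obtain t where "t > 0" "card {x. \<bar>f x\<bar> > t} \<ge> k" by blast
  with le_kth_largest[OF assms this] show ?thesis by simp
next
  case False
  then have "{t. t > 0 \<and> card {x. \<bar>f x\<bar> > t} \<ge> k} = {}" by blast
  then show ?thesis unfolding kth_largest_def Let_def by simp
qed

lemma less_kth_largestD:
  assumes "k \<ge> 1" "0 \<le> s" "s < kth_largest f k"
  shows "\<exists>t>s. card {x. \<bar>f x\<bar> > t} \<ge> k"
proof -
  let ?T = "{t. t > 0 \<and> card {x. \<bar>f x\<bar> > t} \<ge> k}"
  have "?T \<noteq> {}"
  proof
    assume "?T = {}"
    then have "kth_largest f k = 0" unfolding kth_largest_def Let_def by simp
    with assms show False by simp
  qed
  moreover from this have "kth_largest f k = Sup ?T" unfolding kth_largest_def Let_def by (rule if_not_P)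
  then have "s < Sup ?T" using assms by simp
  ultimately show ?thesis using less_cSupD[of ?T s] by blast
qed

lemma kth_largest_antimono:
  assumes "1 \<le> k" "k \<le> k'"
  shows "kth_largest f k' \<le> kth_largest f k"
proof (rule ccontr)
  assume "\<not> ?thesis"
  then obtain t where "t > kth_largest f k" "card {x. \<bar>f x\<bar> > t} \<ge> k'"
    using less_kth_largestD[of k' "kth_largest f k"] kth_largest_nonneg[of k] assms by auto
  then show False using le_kth_largest[of k t] kth_largest_nonneg[of k] assms by force
qed

text \<open>If \<open>k\<close> points had |f| above the \<open>k\<close>-th value, any
  \<open>t\<close> strictly between that value and their minimum would contradict the supremum.
  Finiteness comes from the same argument; it is not immediate when the \<open>k\<close>-th value is
  0 and the set is the support of \<open>f\<close>.\<close>

lemma card_greater_kth_largest: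
  assumes "k \<ge> 1"
  shows "finite {x. \<bar>f x\<bar> > kth_largest f k}" and "card {x. \<bar>f x\<bar> > kth_largest f k} < k"
proof -
  let ?C = "{x. \<bar>f x\<bar> > kth_largest f k}"
  have no: False if S: "S \<subseteq> ?C" "finite S" "card S = k" for S
  proof -
    have ne: "S \<noteq> {}" using S assms by auto
    define m where "m = Min ((\<lambda>x. \<bar>f x\<bar>) ` S)"
    have "m \<in> (\<lambda>x. \<bar>f x\<bar>) ` S" unfolding m_def using S ne by (intro Min_in) auto
    then have "m > kth_largest f k" using S by auto
    then obtain t where t: "kth_largest f k < t" "t < m" using dense by blast
    have "t > 0" using t kth_largest_nonneg[OF assms] by linarith
    have "S \<subseteq> {x. \<bar>f x\<bar> > t}"
    proof
      fix x assume "x \<in> S"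
      then have "m \<le> \<bar>f x\<bar>" unfolding m_def using S by (intro Min_le) auto
      then show "x \<in> {x. \<bar>f x\<bar> > t}" using t by auto
    qed
    then have "k \<le> card {x. \<bar>f x\<bar> > t}" using card_mono[OF finite_superlevel[OF \<open>t > 0\<close>]] S by metis
    then show False using le_kth_largest[OF assms \<open>t > 0\<close>] t by linarith
  qed
  show fin: "finite ?C"
    using infinite_arbitrarily_large[of ?C k] no by blast
  show "card ?C < k"
  proof (rule ccontr)
    assume "\<not> ?thesis"
    then obtain S where "S \<subseteq> ?C" "card S = k" "finite S"
      using obtain_subset_with_card_n[of k ?C] by (auto simp: not_less)
    then show False using no by blast
  qed
qed

text \<open>Only finitely many points have |f| above half of a positive \<open>k\<close>-th value,
  so the values of |f| strictly below the \<open>k\<close>-th one stay below some \<open>s\<close>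
  smaller than it. A level \<open>t > s\<close> exceeded by \<open>k\<close> points then selects
  only points of the set in question.\<close>

lemma card_ge_kth_largest:
  assumes "k \<ge> 1" "kth_largest f k > 0"
  shows "finite {x. \<bar>f x\<bar> \<ge> kth_largest f k}" and "card {x. \<bar>f x\<bar> \<ge> kth_largest f k} \<ge> k"
proof -
  let ?a = "kth_largest f k" and ?A = "{x. \<bar>f x\<bar> \<ge> kth_largest f k}"
  have fin: "finite {x. \<bar>f x\<bar> > ?a / 2}" by (rule finite_superlevel) (use assms in simp)
  show finA: "finite ?A" by (rule finite_subset[OF _ fin]) (use assms in auto)
  define s where "s = Max (insert (?a / 2) ((\<lambda>x. \<bar>f x\<bar>) ` ({x. \<bar>f x\<bar> > ?a / 2} - ?A)))"
  have finS: "finite (insert (?a / 2) ((\<lambda>x. \<bar>f x\<bar>) ` ({x. \<bar>f x\<bar> > ?a / 2} - ?A)))"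
    using fin by blast
  have s: "s < ?a" unfolding s_def by (subst Max_less_iff[OF finS]) (use assms in auto)
  have s2: "s \<ge> ?a / 2" unfolding s_def by (rule Max_ge[OF finS]) simp
  obtain t where t: "t > s" "card {x. \<bar>f x\<bar> > t} \<ge> k"
    using less_kth_largestD[OF assms(1), of s] s s2 assms by auto
  have "{x. \<bar>f x\<bar> > t} \<subseteq> ?A"
  proof (rule ccontr)
    assume "\<not> ?thesis"
    then obtain x where x: "\<bar>f x\<bar> > t" "x \<notin> ?A" by auto
    then have "x \<in> {x. \<bar>f x\<bar> > ?a / 2} - ?A" using s2 t by auto
    then have "\<bar>f x\<bar> \<le> s" unfolding s_def by (intro Max_ge[OF finS]) blast
    then show False using x t by simp
  qed
  then show "card ?A \<ge> k" using card_mono[OF finA] t by (meson le_trans)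
qed

end

subsection \<open>Edge isoperimetry\<close>

definition row_exits :: "lattice set \<Rightarrow> lattice set \<Rightarrow> (lattice \<times> lattice) set" where
  "row_exits A C = {(u, v). u \<in> A \<and> v \<notin> C \<and> snd u = snd v \<and> \<bar>fst u - fst v\<bar> = 1}"

definition exits :: "lattice set \<Rightarrow> lattice set \<Rightarrow> (lattice \<times> lattice) set" where
  "exits A C = {(u, v). u \<in> A \<and> v \<notin> C \<and> adjacent u v}"

lemma finite_exits: "finite A \<Longrightarrow> finite (exits A C)"
proof (rule finite_subset)
  show "exits A C \<subseteq> (\<lambda>((x, y), a, b). ((x, y), x + a, y + b)) ` (A \<times> ({-1..1} \<times> {-1..1}))"
    by (auto simp: exits_def adjacent_def image_iff Bex_def)
      (smt (verit, best) add_diff_cancel_left' diff_add_cancel)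
qed simp

text \<open>In each occupied row of \<open>A\<close>, the points just beyond the two ends are
  outside \<open>A\<close>, and all these points are distinct. Each of them is either in
  \<open>C - A\<close> or outside \<open>C\<close>, and in the latter case it is the target of an
  exit.\<close>

lemma card_row_exits:
  assumes "finite C" "A \<subseteq> C"
  shows "2 * card (snd ` A) \<le> card (row_exits A C) + card (C - A)"
proof -
  have finA: "finite A" using assms finite_subset by blast
  define R where "R y = Max {x. (x, y) \<in> A}" for y
  define L where "L y = Min {x. (x, y) \<in> A}" for y
  have fin: "finite {x. (x, y) \<in> A}" for y
    by (rule finite_subset[of _ "fst ` A"]) (use finA in \<open>force+\<close>)
  have RL: "(R y, y) \<in> A" "(L y, y) \<in> A" "(R y + 1, y) \<notin> A" "(L y - 1, y) \<notin> A" "L y \<le> R y"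
    if "y \<in> snd ` A" for y
  proof -
    have ne: "{x. (x, y) \<in> A} \<noteq> {}" using that by force
    show "(R y, y) \<in> A" "(L y, y) \<in> A"
      using Max_in[OF fin ne] Min_in[OF fin ne] by (auto simp: R_def L_def)
    show "(R y + 1, y) \<notin> A"
      using Max_ge[OF fin, of "R y + 1" y] by (force simp: R_def)
    show "(L y - 1, y) \<notin> A"
      using Min_le[OF fin, of "L y - 1" y] by (force simp: L_def)
    show "L y \<le> R y" using Min_le[OF fin, of "R y" y] \<open>(R y, y) \<in> A\<close> by (auto simp: L_def)
  qed
  let ?r = "\<lambda>y. (R y + 1, y)" and ?l = "\<lambda>y. (L y - 1, y)"
  define H where "H = ?r ` snd ` A \<union> ?l ` snd ` A"
  have finH: "finite H" using finA by (simp add: H_def)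
  have "card H = card (?r ` snd ` A) + card (?l ` snd ` A)"
    unfolding H_def by (rule card_Un_disjoint) (use finA RL(5) in \<open>force+\<close>)
  moreover have "card (?r ` snd ` A) = card (snd ` A)" "card (?l ` snd ` A) = card (snd ` A)"
    by (auto intro!: card_image inj_onI)
  ultimately have "2 * card (snd ` A) = card H" by simp
  also have "\<dots> \<le> card ((H - C) \<union> (C - A))"
    by (rule card_mono) (use finH assms RL(3,4) in \<open>auto simp: H_def\<close>)
  also have "\<dots> \<le> card (H - C) + card (C - A)" by (rule card_Un_le)
  also have "card (H - C) \<le> card (row_exits A C)"
  proof (rule surj_card_le)
    have "row_exits A C \<subseteq> exits A C" by (auto simp: row_exits_def exits_def adjacent_def)
    then show "finite (row_exits A C)" using finite_exits[OF finA] finite_subset by blast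
    show "H - C \<subseteq> snd ` row_exits A C"
    proof
      fix v assume v: "v \<in> H - C"
      then consider y where "y \<in> snd ` A" "v = ?r y" | y where "y \<in> snd ` A" "v = ?l y"
        by (auto simp: H_def)
      then show "v \<in> snd ` row_exits A C"
      proof cases
        case 1
        then have "((R y, y), v) \<in> row_exits A C" using RL v by (auto simp: row_exits_def)
        then show ?thesis by force
      next
        case 2
        then have "((L y, y), v) \<in> row_exits A C" using RL v by (auto simp: row_exits_def)
        then show ?thesis by force
      qed
    qed
  qed
  finally show ?thesis by simp
qed

text \<open>Columns become rows under swapping coordinates, and horizontal and vertical exits are
  disjoint. A point of \<open>C - A\<close> can block an exit once for its row and once for its
  column, hence the factor 2.\<close>

lemma card_exits:
  assumes "finite C" "A \<subseteq> C"
  shows "2 * (card (fst ` A) + card (snd ` A)) \<le> card (exits A C) + 2 * card (C - A)"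
proof -
  let ?s = "prod.swap :: lattice \<Rightarrow> lattice"
    and ?m = "map_prod prod.swap prod.swap :: lattice \<times> lattice \<Rightarrow> _"
  have finA: "finite A" using assms finite_subset by blast
  have inj: "inj ?s" "inj ?m" by (auto intro!: injI simp: prod_eq_iff)
  have "?s ` A \<subseteq> ?s ` C" using assms by auto
  from card_row_exits[OF _ this]
  have "2 * card (snd ` ?s ` A) \<le> card (row_exits (?s ` A) (?s ` C)) + card (?s ` C - ?s ` A)"
    using assms by simp
  moreover have "snd ` ?s ` A = fst ` A" by (force simp: image_image)
  moreover have "card (?s ` C - ?s ` A) = card (C - A)"
    unfolding image_set_diff[OF inj(1), symmetric] by (rule card_image) (use inj in \<open>auto intro: inj_on_subset\<close>)
  moreover have "card (row_exits (?s ` A) (?s ` C)) = card (?m ` row_exits (?s ` A) (?s ` C))"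
    by (rule card_image[symmetric]) (use inj in \<open>auto intro: inj_on_subset\<close>)
  ultimately have 1: "2 * card (fst ` A) \<le> card (?m ` row_exits (?s ` A) (?s ` C)) + card (C - A)"
    by simp
  have "card (?m ` row_exits (?s ` A) (?s ` C)) + card (row_exits A C)
      = card (?m ` row_exits (?s ` A) (?s ` C) \<union> row_exits A C)"
  proof (rule card_Un_disjoint[symmetric])
    have fin: "finite (row_exits B D)" if "finite B" for B D
      by (rule finite_subset[OF _ finite_exits[OF that]]) (auto simp: row_exits_def exits_def adjacent_def)
    then show "finite (?m ` row_exits (?s ` A) (?s ` C))" "finite (row_exits A C)"
      using finA by simp_all
    show "?m ` row_exits (?s ` A) (?s ` C) \<inter> row_exits A C = {}"
      by (auto simp: row_exits_def)
  qed
  also have "\<dots> \<le> card (exits A C)"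
    by (rule card_mono[OF finite_exits[OF finA]])
      (auto simp: row_exits_def exits_def adjacent_def image_iff)
  finally show ?thesis using 1 card_row_exits[OF assms] by simp
qed

lemma card_le_rows_columns:
  fixes A :: "lattice set"
  assumes "finite A"
  shows "4 * card A \<le> (card (fst ` A) + card (snd ` A))\<^sup>2"
proof -
  have "card A \<le> card (fst ` A \<times> snd ` A)"
    by (rule card_mono) (use assms in \<open>force+\<close>)
  then have "card A \<le> card (fst ` A) * card (snd ` A)" by (simp add: card_cartesian_product)
  moreover have "4 * (r * c) \<le> (r + c)\<^sup>2" for r c :: nat
    using sum_squares_bound[of "real r" "real c"]
    by (simp add: power2_eq_square algebra_simps flip: of_nat_le_iff[where 'a = real])
  ultimately show ?thesis by (meson le_trans mult_le_mono2)
qed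

subsection \<open>Comparison of the energies\<close>

lemma spiral_rearrangement_eq:
  "spiral_rearrangement f v = kth_largest f (nat (spiral_label v))"
  by (simp only: spiral_rearrangement_def rearrangement_def inv_into_spiral)

section \<open>Counting edges by their smaller label\<close>

definition neighbours :: "lattice \<Rightarrow> lattice set" where
  "neighbours v = {w. adjacent v w}"

lemma neighbours_eq:
  "neighbours (x, y) = {(x + 1, y), (x - 1, y), (x, y + 1), (x, y - 1)}"
  unfolding neighbours_def adjacent_def by auto

lemma finite_neighbours: "finite (neighbours v)" and card_neighbours: "card (neighbours v) \<le> 4"
  by (cases v; simp add: neighbours_eq card_insert_if)+

lemma lattice_edge_cases:
  assumes "e \<in> lattice_edges"
  obtains u v where "e = {u, v}" "adjacent u v" "spiral_label u < spiral_label v"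
proof -
  obtain u v where e: "e = {u, v}" "adjacent u v" using assms by (auto simp: lattice_edges_def)
  then have "u \<noteq> v" by (auto simp: adjacent_def)
  then have "spiral_label u \<noteq> spiral_label v" using injD[OF inj_spiral_label] by blast
  then consider "spiral_label u < spiral_label v" | "spiral_label v < spiral_label u" by linarith
  then show ?thesis
  proof cases
    case 1
    with e show ?thesis by (rule that)
  next
    case 2
    have "e = {v, u}" "adjacent v u" using e by (auto simp: adjacent_def)
    then show ?thesis using 2 by (rule that)
  qed
qed

definition lower_label :: "lattice set \<Rightarrow> nat" where
  "lower_label e = Min ((\<lambda>v. nat (spiral_label v)) ` e)"

lemma lower_label_pair:
  assumes "spiral_label u < spiral_label v"
  shows "lower_label {u, v} = nat (spiral_label u)"
  using assms by (simp add: lower_label_def)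

lemma lower_label_ge_1: "e \<in> lattice_edges \<Longrightarrow> lower_label e \<ge> 1"
proof (erule lattice_edge_cases)
  fix u v assume "e = {u, v}" "spiral_label u < spiral_label v"
  then show ?thesis using spiral_label_ge_1[of u] by (simp add: lower_label_pair)
qed

text \<open>Such an edge joins \<open>spiral i\<close> to a neighbour with a larger label. For
  \<open>i > 1\<close> one of the four neighbours is the predecessor \<open>spiral (i - 1)\<close>,
  which leaves three.\<close>

lemma edges_with_lower_label:
  assumes "i \<ge> 1"
  shows "finite {e \<in> lattice_edges. lower_label e = i}"
    and "card {e \<in> lattice_edges. lower_label e = i} \<le> (if i = 1 then 4 else 3)"
proof -
  define N where "N = neighbours (spiral i) - (if i = 1 then {} else {spiral (i - 1)})"
  have sub: "{e \<in> lattice_edges. lower_label e = i} \<subseteq> (\<lambda>w. {spiral i, w}) ` N"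
  proof
    fix e assume e: "e \<in> {e \<in> lattice_edges. lower_label e = i}"
    then have "e \<in> lattice_edges" by simp
    then obtain u v where uv: "e = {u, v}" "adjacent u v" "spiral_label u < spiral_label v"
      by (rule lattice_edge_cases)
    have "i = nat (spiral_label u)" using e lower_label_pair[OF uv(3)] uv(1) by simp
    then have u: "u = spiral i" by (simp only: spiral_of_label)
    have "v \<noteq> spiral (i - 1)" if "i \<noteq> 1"
    proof
      assume "v = spiral (i - 1)"
      then have "spiral_label v = int (i - 1)" using that assms spiral_label_spiral[of "i - 1"] by simp
      moreover have "spiral_label u = int i" using spiral_label_spiral[OF assms] u by simp
      ultimately show False using uv(3) by simp
    qed
    then have "v \<in> N" using uv(2) u by (cases "i = 1") (simp_all add: N_def neighbours_def)
    then show "e \<in> (\<lambda>w. {spiral i, w}) ` N" unfolding uv(1) u by (rule imageI)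
  qed
  have finN: "finite N" by (simp add: N_def finite_neighbours)
  show "finite {e \<in> lattice_edges. lower_label e = i}"
    by (rule finite_subset[OF sub]) (simp add: finN)
  have "card N \<le> (if i = 1 then 4 else 3)"
  proof (cases "i = 1")
    case True
    then show ?thesis by (simp add: N_def card_neighbours)
  next
    case False
    then have "adjacent (spiral (i - 1)) (spiral i)" using assms adjacent_spiral_Suc[of "i - 1"] by simp
    then have "spiral (i - 1) \<in> neighbours (spiral i)"
      by (auto simp: neighbours_def adjacent_def)
    then show ?thesis using False card_neighbours[of "spiral i"] by (simp add: N_def)
  qed
  then show "card {e \<in> lattice_edges. lower_label e = i} \<le> (if i = 1 then 4 else 3)"
    using surj_card_le[OF finN sub] by linarith
qed

lemma card_edges_lower_label_in:
  assumes "finite I" "I \<subseteq> {1..}"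
  shows "card {e \<in> lattice_edges. lower_label e \<in> I} \<le> 3 * card I + 1"
proof -
  have "{e \<in> lattice_edges. lower_label e \<in> I} = (\<Union>i\<in>I. {e \<in> lattice_edges. lower_label e = i})"
    by auto
  then have "card {e \<in> lattice_edges. lower_label e \<in> I} \<le> (\<Sum>i\<in>I. card {e \<in> lattice_edges. lower_label e = i})"
    by (simp only: card_UN_le[OF assms(1)])
  also have "\<dots> \<le> (\<Sum>i\<in>I. 3 + (if i = 1 then 1 else 0))"
  proof (rule sum_mono)
    fix i assume "i \<in> I"
    then have "i \<ge> 1" using assms(2) by auto
    from edges_with_lower_label(2)[OF this]
    show "card {e \<in> lattice_edges. lower_label e = i} \<le> 3 + (if i = 1 then 1 else 0)"
      by (cases "i = 1") simp_all
  qed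
  also have "\<dots> \<le> 3 * card I + 1"
  proof -
    have "(\<Sum>i\<in>I. (if i = 1 then 1 else 0 :: nat)) \<le> 1"
      by (subst sum.delta[OF assms(1)]) simp
    then show ?thesis by (simp only: sum.distrib sum_constant) simp
  qed
  finally show ?thesis .
qed

lemma finite_edges_lower_label_in:
  assumes "finite I" "I \<subseteq> {1..}"
  shows "finite {e \<in> lattice_edges. lower_label e \<in> I}"
proof -
  have "{e \<in> lattice_edges. lower_label e \<in> I} = (\<Union>i\<in>I. {e \<in> lattice_edges. lower_label e = i})"
    by auto
  moreover have "finite {e \<in> lattice_edges. lower_label e = i}" if "i \<in> I" for i
    using that assms(2) by (intro edges_with_lower_label(1)) auto
  ultimately show ?thesis using assms(1) by simp
qed

definition edge_level :: "lattice set \<Rightarrow> nat" where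
  "edge_level e = triangle_level (lower_label e)"

text \<open>These are the edges whose window of four levels contains \<open>l\<close>. Their lower
  labels range from \<open>triangle (l - 3)\<close> to below \<open>triangle (l + 1)\<close>, at
  most \<open>4 * l - 2\<close> labels, and \<open>3 * (4 * l - 2) + 1 = 12 * l - 5\<close>. The
  small \<open>l\<close>, where the subtraction truncates or the label 0 must be excluded, are
  checked directly.\<close>

lemma card_edges_near_level:
  assumes "l \<ge> 1"
  defines "W \<equiv> {e \<in> lattice_edges. edge_level e \<le> l \<and> l < edge_level e + 4}"
  shows "finite W" and "card W + 5 \<le> 12 * l"
proof -
  define I where "I = {max 1 (triangle (l - 3))..<triangle (Suc l)}"
  have I: "finite I" "I \<subseteq> {1..}" by (auto simp: I_def)
  have sub: "W \<subseteq> {e \<in> lattice_edges. lower_label e \<in> I}"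
  proof
    fix e assume "e \<in> W"
    then have e: "e \<in> lattice_edges" "edge_level e \<le> l" "l - 3 \<le> edge_level e" by (auto simp: W_def)
    note b = triangle_level_bounds[of "lower_label e", folded edge_level_def]
    have "triangle (l - 3) \<le> triangle (edge_level e)" "triangle (Suc (edge_level e)) \<le> triangle (Suc l)"
      using e by (auto intro!: monoD[OF mono_triangle])
    then show "e \<in> {e \<in> lattice_edges. lower_label e \<in> I}"
      using b e lower_label_ge_1[OF e(1)] by (auto simp: I_def)
  qed
  note fin = finite_edges_lower_label_in[OF I]
  show "finite W" by (rule finite_subset[OF sub fin])
  have "card I + 2 \<le> 4 * l"
  proof (cases "l \<ge> 4")
    case True
    define m where "m = l - 3"
    then have m: "l = m + 3" "m \<ge> 1" using True by simp_all
    have "triangle (Suc l) = triangle m + 4 * m + 10"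
      unfolding m(1) by (simp add: triangle_Suc numeral_eq_Suc)
    moreover have "triangle m \<ge> triangle 1" using m by (intro monoD[OF mono_triangle])
    ultimately show ?thesis using m by (simp add: I_def triangle_Suc max_def)
  next
    case False
    then have "l = 1 \<or> l = 2 \<or> l = 3" using assms by auto
    then show ?thesis by (auto simp: I_def triangle_def)
  qed
  moreover have "card W \<le> 3 * card I + 1"
    using card_mono[OF fin sub] card_edges_lower_label_in[OF I] by linarith
  ultimately show "card W + 5 \<le> 12 * l" by linarith
qed

section \<open>Both energies against the level drops\<close>

context
  fixes f :: "lattice \<Rightarrow> real"
  assumes f: "vanishes_at_infinity f"
begin

definition level_drop :: "nat \<Rightarrow> real" where
  "level_drop l = kth_largest f (triangle l) - kth_largest f (triangle (Suc l))"

lemma kth_largest_triangle_antimono: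
  assumes "1 \<le> l" "l \<le> m"
  shows "kth_largest f (triangle m) \<le> kth_largest f (triangle l)"
proof (rule kth_largest_antimono[OF f])
  have "triangle 1 \<le> triangle l" using assms by (intro monoD[OF mono_triangle])
  then show "1 \<le> triangle l" by (simp add: triangle_def)
qed (use assms in \<open>auto intro: monoD[OF mono_triangle]\<close>)

lemma level_drop_nonneg: "l \<ge> 1 \<Longrightarrow> level_drop l \<ge> 0"
  using kth_largest_triangle_antimono[of l "Suc l"] by (simp add: level_drop_def)

lemma edge_level_ge_1:
  assumes "e \<in> lattice_edges"
  shows "edge_level e \<ge> 1"
proof (rule ccontr)
  assume "\<not> ?thesis"
  then have "edge_level e = 0" by simp
  then have "lower_label e < triangle 1"
    using triangle_level_bounds(2)[of "lower_label e"] unfolding edge_level_def by simp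
  then show False using lower_label_ge_1[OF assms] by (simp add: triangle_def)
qed

text \<open>If \<open>m\<close> is the level of the smaller label, both labels lie between
  \<open>triangle m\<close> and \<open>triangle (m + 4)\<close>; the decrease of
  \<open>kth_largest f\<close> between these two indices telescopes.\<close>

lemma edge_increment_rearrangement_le:
  assumes "e \<in> lattice_edges"
  shows "edge_increment (spiral_rearrangement f) e
    \<le> (\<Sum>l\<in>{edge_level e..<edge_level e + 4}. level_drop l)"
proof -
  obtain u v where uv: "e = {u, v}" "adjacent u v" "spiral_label u < spiral_label v"
    using assms by (rule lattice_edge_cases)
  define i j m where "i = nat (spiral_label u)" and "j = nat (spiral_label v)" and "m = edge_level e"
  have ij: "1 \<le> i" "i < j" using uv(3) spiral_label_ge_1[of u] by (auto simp: i_def j_def)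
  have "lower_label e = i" using uv by (simp add: lower_label_pair i_def)
  then have m: "triangle m \<le> i" "i < triangle (Suc m)"
    using triangle_level_bounds[of i] by (simp_all add: m_def edge_level_def)
  have "m \<ge> 1" using edge_level_ge_1[OF assms] m_def by simp
  then have "triangle m \<ge> 1" using monoD[OF mono_triangle, of 1 m] by (simp add: triangle_def)
  have "spiral_label v \<le> int (triangle (m + 4))"
    by (rule spiral_label_span_triangle[OF uv(2)]) (use m i_def in linarith)
  then have j: "j \<le> triangle (m + 4)" by (simp add: j_def)
  have "edge_increment (spiral_rearrangement f) e = \<bar>kth_largest f i - kth_largest f j\<bar>"
    unfolding uv(1) edge_increment_pair spiral_rearrangement_eq i_def j_def ..
  also have "\<dots> = kth_largest f i - kth_largest f j"
    using kth_largest_antimono[OF f, of i j] ij by simp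
  also have "\<dots> \<le> kth_largest f (triangle m) - kth_largest f (triangle (m + 4))"
    using kth_largest_antimono[OF f] ij m j \<open>triangle m \<ge> 1\<close> by (intro diff_mono) auto
  also have "\<dots> = (\<Sum>l\<in>{m..<m + 4}. level_drop l)"
    using sum_Suc_diff'[of m "m + 4" "\<lambda>l. - kth_largest f (triangle l)"]
    by (simp add: level_drop_def)
  finally show ?thesis by (simp add: m_def)
qed

text \<open>Jensen's inequality for four terms costs \<open>4 powr (p - 1)\<close>. After the sums
  are exchanged, level \<open>l\<close> appears once for every edge of \<open>F\<close> whose window
  contains it.\<close>

lemma rearrangement_sum_le:
  assumes "finite F" "F \<subseteq> lattice_edges" "p \<ge> 1"
  shows "\<exists>L. (\<Sum>e\<in>F. edge_increment (spiral_rearrangement f) e powr p)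
    \<le> 4 powr (p - 1) * (\<Sum>l\<in>{1..L}. (12 * real l - 5) * level_drop l powr p)"
proof -
  \<comment> \<open>Large enough for the windows of all edges of \<open>F\<close> to lie in
    \<open>{1..L}\<close>; the inserted 0 keeps \<open>Max\<close> meaningful for empty
    \<open>F\<close>.\<close>
  define L where "L = Max (insert 0 (edge_level ` F)) + 4"
  let ?near = "\<lambda>e l. edge_level e \<le> l \<and> l < edge_level e + 4"
  have L: "edge_level e + 4 \<le> L" if "e \<in> F" for e
    using that assms(1) by (auto simp: L_def)
  have "(\<Sum>e\<in>F. edge_increment (spiral_rearrangement f) e powr p)
      \<le> (\<Sum>e\<in>F. 4 powr (p - 1) * (\<Sum>l\<in>{l\<in>{1..L}. ?near e l}. level_drop l powr p))"
  proof (rule sum_mono)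
    fix e assume e: "e \<in> F"
    then have e': "e \<in> lattice_edges" using assms by auto
    have eq: "{l\<in>{1..L}. ?near e l} = {edge_level e..<edge_level e + 4}"
      using edge_level_ge_1[OF e'] L[OF e] by auto
    have "0 \<le> edge_increment (spiral_rearrangement f) e"
      using e' by (elim lattice_edge_cases) (simp add: edge_increment_pair)
    then have "edge_increment (spiral_rearrangement f) e powr p
        \<le> (\<Sum>l\<in>{edge_level e..<edge_level e + 4}. level_drop l) powr p"
      using edge_increment_rearrangement_le[OF e'] assms(3) by (intro powr_mono2) auto
    also have "\<dots> \<le> real (card {edge_level e..<edge_level e + 4}) powr (p - 1) *
        (\<Sum>l\<in>{edge_level e..<edge_level e + 4}. level_drop l powr p)"
      using edge_level_ge_1[OF e'] assms(3) by (intro powr_mean_le) (auto intro: level_drop_nonneg)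
    finally show "edge_increment (spiral_rearrangement f) e powr p
        \<le> 4 powr (p - 1) * (\<Sum>l\<in>{l\<in>{1..L}. ?near e l}. level_drop l powr p)"
      unfolding eq by simp
  qed
  also have "\<dots> = 4 powr (p - 1) * (\<Sum>l\<in>{1..L}. \<Sum>e\<in>{e\<in>F. ?near e l}. level_drop l powr p)"
    unfolding sum_distrib_left[symmetric] using assms(1) by (subst sum.swap_restrict) auto
  also have "\<dots> = 4 powr (p - 1) * (\<Sum>l\<in>{1..L}. real (card {e\<in>F. ?near e l}) * level_drop l powr p)"
    by simp
  also have "\<dots> \<le> 4 powr (p - 1) * (\<Sum>l\<in>{1..L}. (12 * real l - 5) * level_drop l powr p)"
  proof (intro mult_left_mono sum_mono mult_right_mono)
    fix l assume "l \<in> {1..L}"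
    then have l: "l \<ge> 1" by simp
    note W = card_edges_near_level[OF l]
    have "card {e\<in>F. ?near e l} \<le> card {e \<in> lattice_edges. ?near e l}"
      using assms by (intro card_mono[OF W(1)]) auto
    with W(2) show "real (card {e\<in>F. ?near e l}) \<le> 12 * real l - 5" by linarith
  qed auto
  finally show ?thesis by blast
qed

definition crossing_edges :: "nat \<Rightarrow> lattice set set" where
  "crossing_edges l = (\<lambda>(u, v). {u, v}) ` exits {x. \<bar>f x\<bar> \<ge> kth_largest f (triangle l)}
     {x. \<bar>f x\<bar> > kth_largest f (triangle (Suc l))}"

text \<open>Let \<open>s\<close> count the occupied rows and columns of \<open>?A\<close>. From
  \<open>card ?A \<ge> triangle l\<close> follows \<open>s\<^sup>2 \<ge> 2 * l * (l + 1)\<close>,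
  while \<open>?C - ?A\<close> has at most \<open>l\<close> points, so there are at least
  \<open>2 * s - 2 * l\<close> exits. The positive drop ensures \<open>?A \<subseteq> ?C\<close> and
  a positive value at \<open>triangle l\<close>.\<close>

lemma card_crossing_edges:
  assumes "l \<ge> 1" "level_drop l > 0"
  shows "finite (crossing_edges l)" and "12 * real l - 5 \<le> 16 * real (card (crossing_edges l))"
proof -
  let ?A = "{x. \<bar>f x\<bar> \<ge> kth_largest f (triangle l)}"
  let ?C = "{x. \<bar>f x\<bar> > kth_largest f (triangle (Suc l))}"
  have T: "triangle l \<ge> 1" "triangle (Suc l) \<ge> 1"
    using monoD[OF mono_triangle, of 1 l] monoD[OF mono_triangle, of 1 "Suc l"] assms(1)
    by (auto simp: triangle_def)
  have pos: "kth_largest f (triangle l) > 0"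
    using assms(2) kth_largest_nonneg[OF f T(2)] by (simp add: level_drop_def)
  have A: "finite ?A" "card ?A \<ge> triangle l"
    using card_ge_kth_largest[OF f T(1) pos] by auto
  have C: "finite ?C" "card ?C < triangle (Suc l)"
    using card_greater_kth_largest[OF f T(2)] by auto
  have AC: "?A \<subseteq> ?C" using assms(2) by (auto simp: level_drop_def)
  define N s where "N = card (crossing_edges l)" and "s = card (fst ` ?A) + card (snd ` ?A)"
  show "finite (crossing_edges l)"
    unfolding crossing_edges_def using finite_exits[OF A(1)] by simp
  \<comment> \<open>An exit can be recovered from its unordered edge: one end is in
    \<open>?A\<close>, hence in \<open>?C\<close>, and the other end is not in
    \<open>?C\<close>.\<close>
  have "inj_on (\<lambda>(u, v). {u, v}) (exits ?A ?C)"
    using AC by (auto simp: inj_on_def exits_def doubleton_eq_iff)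
  then have N: "N = card (exits ?A ?C)"
    unfolding N_def crossing_edges_def by (rule card_image)
  have "card (?C - ?A) = card ?C - card ?A" by (rule card_Diff_subset[OF A(1) AC])
  moreover have "triangle (Suc l) = triangle l + Suc l" by (rule triangle_Suc)
  ultimately have "card (?C - ?A) \<le> l" using A C by linarith
  then have 1: "2 * s \<le> N + 2 * l" using card_exits[OF C(1) AC] N s_def by simp
  have "4 * triangle l \<le> s\<^sup>2" using card_le_rows_columns[OF A(1), folded s_def] A(2) by linarith
  then have "2 * (l * (l + 1)) \<le> s\<^sup>2" using double_triangle[of l] by linarith
  then have sq: "2 * (real l * (real l + 1)) \<le> (real s)\<^sup>2"
    by (metis (mono_tags) of_nat_1 of_nat_add of_nat_le_iff of_nat_mult of_nat_numeral of_nat_power)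
  \<comment> \<open>The goal reduces to \<open>32 * s - 32 * l \<ge> 12 * l - 5\<close>, and 44 is
    \<open>12 + 32\<close>. It suffices that \<open>44\<^sup>2 = 1936\<close> is at most
    \<open>2 * 32\<^sup>2 = 2048\<close>.\<close>
  have "44 * real l - 5 \<le> 32 * real s"
  proof (rule power2_le_imp_le)
    have "(44 * real l - 5)\<^sup>2 \<le> (44 * real l)\<^sup>2"
      using assms(1) by (intro power_mono) auto
    also have "\<dots> \<le> 1024 * (2 * (real l * (real l + 1)))"
      by (simp add: power2_eq_square algebra_simps)
    also have "\<dots> \<le> 1024 * (real s)\<^sup>2" using sq by (rule mult_left_mono) simp
    finally show "(44 * real l - 5)\<^sup>2 \<le> (32 * real s)\<^sup>2" by (simp add: power_mult_distrib)
  qed simp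
  then show "12 * real l - 5 \<le> 16 * real (card (crossing_edges l))"
    using 1 unfolding N_def[symmetric] by linarith
qed

text \<open>The weight of a level is at most 16 times the number of edges crossing it. Exchanging
  the sums charges each edge for all the levels it crosses, and superadditivity bounds that charge
  by the \<open>p\<close>-th power of its increment.\<close>

lemma sum_level_drop_le_energy:
  assumes "p \<ge> 1"
  shows "ennreal (\<Sum>l\<in>{1..L}. (12 * real l - 5) * level_drop l powr p) \<le> 16 * grad_energy p f"
proof -
  define S where "S = {l\<in>{1..L}. level_drop l > 0}"
  define X where "X = (\<Union>l\<in>S. crossing_edges l)"
  have S: "finite S" "\<And>l. l \<in> S \<Longrightarrow> l \<ge> 1 \<and> level_drop l > 0" by (auto simp: S_def)
  have finX: "finite X" unfolding X_def using S card_crossing_edges(1) by blast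
  have XE: "X \<subseteq> lattice_edges"
    by (auto simp: X_def crossing_edges_def exits_def lattice_edges_def)
  have "(\<Sum>l\<in>{1..L}. (12 * real l - 5) * level_drop l powr p)
      = (\<Sum>l\<in>S. (12 * real l - 5) * level_drop l powr p)"
  proof (rule sum.mono_neutral_right)
    show "\<forall>i\<in>{1..L} - S. (12 * real i - 5) * level_drop i powr p = 0"
      using level_drop_nonneg by (force simp: S_def)
  qed (auto simp: S_def)
  also have "\<dots> \<le> (\<Sum>l\<in>S. 16 * real (card (crossing_edges l)) * level_drop l powr p)"
    using card_crossing_edges(2) S by (intro sum_mono mult_right_mono) auto
  also have "\<dots> = 16 * (\<Sum>l\<in>S. \<Sum>e\<in>{e\<in>X. e \<in> crossing_edges l}. level_drop l powr p)"
  proof -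
    have "{e\<in>X. e \<in> crossing_edges l} = crossing_edges l" if "l \<in> S" for l
      using that by (auto simp: X_def)
    then show ?thesis by (simp add: sum_distrib_left mult.assoc)
  qed
  also have "\<dots> = 16 * (\<Sum>e\<in>X. \<Sum>l\<in>{l\<in>S. e \<in> crossing_edges l}. level_drop l powr p)"
    using S(1) finX by (subst sum.swap_restrict) auto
  also have "\<dots> \<le> 16 * (\<Sum>e\<in>X. edge_increment f e powr p)"
  proof (intro mult_left_mono sum_mono)
    fix e assume "e \<in> X"
    then obtain u v where uv: "e = {u, v}" using XE by (auto simp: lattice_edges_def)
    define lo hi where "lo = min \<bar>f u\<bar> \<bar>f v\<bar>" and "hi = max \<bar>f u\<bar> \<bar>f v\<bar>"
    let ?S = "{l\<in>S. e \<in> crossing_edges l}"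
    \<comment> \<open>Each crossed level gives an interval from
      \<open>kth_largest f (triangle (Suc l))\<close> to \<open>kth_largest f (triangle l)\<close>
      inside \<open>[lo, hi]\<close>. Intervals of different levels do not overlap, so their lengths
      add up to at most \<open>hi - lo\<close>.\<close>
    have cross: "lo \<le> kth_largest f (triangle (Suc l))" "kth_largest f (triangle l) \<le> hi"
      if "e \<in> crossing_edges l" for l
      using that unfolding crossing_edges_def uv exits_def lo_def hi_def
      by (auto simp: doubleton_eq_iff)
    have "(\<Sum>l\<in>?S. level_drop l powr p) \<le> (\<Sum>l\<in>?S. level_drop l) powr p"
      using S assms by (intro sum_powr_le_powr_sum) (auto intro: less_imp_le)
    also have "\<dots> \<le> (edge_increment f e) powr p"
    proof (rule powr_mono2)
      show "0 \<le> (\<Sum>l\<in>?S. level_drop l)" using S by (intro sum_nonneg) (auto intro: less_imp_le)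
      have "(\<Sum>l\<in>?S. level_drop l) \<le> hi - lo"
        unfolding level_drop_def
        by (rule sum_decrements_le[where c = "\<lambda>l. kth_largest f (triangle l)"])
          (use S cross kth_largest_triangle_antimono in \<open>auto simp: lo_def hi_def\<close>)
      \<comment> \<open>The reverse triangle inequality passes from |f| back to
        \<open>f\<close>.\<close>
      also have "\<dots> \<le> \<bar>f u - f v\<bar>" unfolding lo_def hi_def by linarith
      finally show "(\<Sum>l\<in>?S. level_drop l) \<le> edge_increment f e"
        by (simp add: uv edge_increment_pair)
    qed (use assms in simp)
    finally show "(\<Sum>l\<in>?S. level_drop l powr p) \<le> edge_increment f e powr p" .
  qed simp
  finally have "ennreal (\<Sum>l\<in>{1..L}. (12 * real l - 5) * level_drop l powr p)
      \<le> ennreal (16 * (\<Sum>e\<in>X. edge_increment f e powr p))"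
    by (rule ennreal_leI)
  also have "\<dots> = 16 * (\<Sum>e\<in>X. ennreal (edge_increment f e powr p))"
    by (simp add: ennreal_mult sum_nonneg sum_ennreal)
  also have "\<dots> \<le> 16 * grad_energy p f"
    unfolding grad_energy_def
    by (intro mult_left_mono, subst nonneg_infsum_complete, simp, rule SUP_upper)
      (use finX XE in auto)
  finally show ?thesis .
qed

text \<open>The same weights \<open>12 * l - 5\<close> occur in both comparisons, so the constants
  multiply: \<open>4 powr (p - 1)\<close> from Jensen's inequality and 16 from edge isoperimetry.
  Finite partial sums suffice on the left.\<close>

lemma grad_energy_spiral_rearrangement_le:
  assumes "p \<ge> 1"
  shows "grad_energy p (spiral_rearrangement f) \<le> ennreal (4 powr (p + 1)) * grad_energy p f"
  unfolding grad_energy_def[of p "spiral_rearrangement f"]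
proof (rule infsum_le_finite_sums)
  show "(\<lambda>e. ennreal (edge_increment (spiral_rearrangement f) e powr p)) summable_on lattice_edges"
    by (rule nonneg_summable_on_complete) simp
  fix F assume F: "finite F" "F \<subseteq> lattice_edges"
  obtain L where L: "(\<Sum>e\<in>F. edge_increment (spiral_rearrangement f) e powr p)
    \<le> 4 powr (p - 1) * (\<Sum>l\<in>{1..L}. (12 * real l - 5) * level_drop l powr p)"
    using rearrangement_sum_le[OF F assms] by blast
  have nn: "0 \<le> (\<Sum>l\<in>{1..L}. (12 * real l - 5) * level_drop l powr p)"
    by (intro sum_nonneg mult_nonneg_nonneg) auto
  have "(\<Sum>e\<in>F. ennreal (edge_increment (spiral_rearrangement f) e powr p))
      = ennreal (\<Sum>e\<in>F. edge_increment (spiral_rearrangement f) e powr p)"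
    by (simp add: sum_ennreal)
  also have "\<dots> \<le> ennreal (4 powr (p - 1)) * ennreal (\<Sum>l\<in>{1..L}. (12 * real l - 5) * level_drop l powr p)"
    using ennreal_leI[OF L] nn by (simp add: ennreal_mult)
  also have "\<dots> \<le> ennreal (4 powr (p - 1)) * (16 * grad_energy p f)"
    by (intro mult_left_mono sum_level_drop_le_energy assms) simp
  also have "\<dots> = ennreal (4 powr (p - 1) * 16) * grad_energy p f"
    by (simp add: ennreal_mult mult.assoc)
  also have "4 powr (p - 1) * 16 = 4 powr (p + 1)"
    by (simp add: powr_diff powr_add)
  finally show "(\<Sum>e\<in>F. ennreal (edge_increment (spiral_rearrangement f) e powr p))
      \<le> ennreal (4 powr (p + 1)) * grad_energy p f" .
qed

end

theorem theorem5p1: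
  fixes f :: "int \<times> int \<Rightarrow> real" and p :: real
  assumes "vanishes_at_infinity f" and "p \<ge> 1"
  shows "grad_norm p (spiral_rearrangement f) \<le> ennreal (4 powr (1 + 1 / p)) * grad_norm p f"
proof (cases "grad_energy p f = \<infinity>")
  case True
  then show ?thesis by (simp add: grad_norm_def ennreal_mult_top)
next
  case False
  then obtain E where E: "grad_energy p f = ennreal E" "E \<ge> 0"
    by (cases "grad_energy p f") auto
  have "grad_energy p (spiral_rearrangement f) \<le> ennreal (4 powr (p + 1) * E)"
    using grad_energy_spiral_rearrangement_le[OF assms] E by (simp add: ennreal_mult)
  then obtain R where R: "grad_energy p (spiral_rearrangement f) = ennreal R" "R \<ge> 0"
      "R \<le> 4 powr (p + 1) * E"
    using E by (cases "grad_energy p (spiral_rearrangement f)") (auto simp: top_unique)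
  have "R powr (1 / p) \<le> (4 powr (p + 1) * E) powr (1 / p)"
    using R assms by (intro powr_mono2) auto
  \<comment> \<open>The exponent is \<open>(p + 1) / p = 1 + 1 / p\<close>.\<close>
  also have "\<dots> = 4 powr (1 + 1 / p) * E powr (1 / p)"
    using assms E by (simp add: powr_mult powr_powr add_divide_distrib)
  finally show ?thesis
    using R E by (simp add: grad_norm_def ennreal_mult[symmetric] ennreal_leI)
qed

end
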